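(* Let $(M^{4n},Q,\omega)$, $n>1$, be an almost quaternionic skew-Hermitian manifold and let $(N^{2k},\hat J)$ be an almost complex submanifold of $M$ which is additionally almost symplectic, i.e. the induced 2-form $\hat\omega=\iota^*\omega$ is non-degenerate on $N$. Then the pair $(\hat g,\hat J)$ is an almost pseudo-Hermitian structure on $N^{2k}$, where $\hat g(X,Y):=\hat\omega(X,\hat JY)$ for $X,Y\in\Gamma(TN)$.
   Context: An almost quaternionic structure on $M^{4n}$ ($n>1$) is a rank-3 subbundle $Q\subset\mathrm{End}(TM)$ locally spanned by an admissible basis $J_1,J_2,J_3$, i.e. $J_a^2=-\mathrm{Id}$, $J_1J_2=J_3=-J_2J_1$. An almost quaternionic skew-Hermitian (qs-H) manifold $(M^{4n},Q,\omega)$ is such a manifold with a non-degenerate 2-form $\omega$ satisfying $\omega(J_aX,J_aY)=\omega(X,Y)$ for every admissible basis. A submanifold $\iota:N^{2k}\to M$ (immersion) with an almost complex structure $\hat J$ on $N$ is an almost complex submanifold of $(M,Q,\omega)$ if for every $x\in N$ there is, near $x$, a section $J$ of $Q$ belonging to an admissible basis with $J(TN)=TN$ and $J|_{TN}=\hat J$. An almost pseudo-Hermitian structure is a pair consisting of a pseudo-Riemannian metric $\hat g$ and an almost complex structure $\hat J$ with $\hat g(\hat JX,\hat JY)=\hat g(X,Y)$. *)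

theory Defs
  imports "HOL-Analysis.Analysis" "HOL-Library.Function_Algebras"
begin

section \<open>Pointwise vector space structure on functions\<close>

instantiation "fun" :: (type, scaleR) scaleR
begin
definition scaleR_fun :: "real \<Rightarrow> ('a \<Rightarrow> 'b) \<Rightarrow> 'a \<Rightarrow> 'b"
  where "scaleR_fun r f = (\<lambda>x. r *\<^sub>R f x)"
instance ..
end

instance "fun" :: (type, real_vector) real_vector
  by standard (simp_all add: scaleR_fun_def fun_eq_iff scaleR_add_right scaleR_add_left)


section \<open>Smooth maps between Euclidean spaces\<close>

text \<open>Only used for open \<open>S\<close>. In finite dimensions, \<open>C\<^sup>k\<^sup>+\<^sup>1\<close> on an open set means differentiable
  with all directional derivatives of class \<open>C\<^sup>k\<close>.\<close>

primrec Ck_on :: "nat \<Rightarrow> 'e::euclidean_space set \<Rightarrow> ('e \<Rightarrow> 'b::real_normed_vector) \<Rightarrow> bool" where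
  "Ck_on 0 S f \<longleftrightarrow> continuous_on S f"
| "Ck_on (Suc k) S f \<longleftrightarrow> (\<forall>x\<in>S. f differentiable (at x)) \<and>
     (\<forall>v. Ck_on k S (\<lambda>x. frechet_derivative f (at x) v))"

definition smooth_on :: "'e::euclidean_space set \<Rightarrow> ('e \<Rightarrow> 'b::real_normed_vector) \<Rightarrow> bool"
  where "smooth_on S f \<longleftrightarrow> (\<forall>k. Ck_on k S f)"


section \<open>Smooth manifolds\<close>

text \<open>The underlying space of a manifold is a (Hausdorff, second countable) type \<open>'m\<close>; its
  dimension is \<open>DIM('e)\<close>. A chart is a pair of a domain and a coordinate map; the values of the
  coordinate map outside the domain are irrelevant. A smooth structure is given by a smooth atlas,
  not required to be maximal: all notions below depend only on the structure it generates.\<close>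

type_synonym ('m, 'e) chart = "'m set \<times> ('m \<Rightarrow> 'e)"

abbreviation chart_dom :: "('m, 'e) chart \<Rightarrow> 'm set" where "chart_dom \<equiv> fst"
abbreviation chart_map :: "('m, 'e) chart \<Rightarrow> 'm \<Rightarrow> 'e" where "chart_map \<equiv> snd"

definition chart_inv :: "('m, 'e) chart \<Rightarrow> 'e \<Rightarrow> 'm"
  where "chart_inv c = inv_into (chart_dom c) (chart_map c)"

definition is_chart :: "('m::topological_space, 'e::euclidean_space) chart \<Rightarrow> bool" where
  "is_chart c \<longleftrightarrow> open (chart_dom c) \<and> open (chart_map c ` chart_dom c) \<and>
     homeomorphism (chart_dom c) (chart_map c ` chart_dom c) (chart_map c) (chart_inv c)"

definition smooth_atlas ::
    "('m::{t2_space, second_countable_topology}, 'e::euclidean_space) chart set \<Rightarrow> bool" where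
  "smooth_atlas A \<longleftrightarrow> (\<forall>c\<in>A. is_chart c) \<and> (\<Union>c\<in>A. chart_dom c) = UNIV \<and>
     (\<forall>c\<in>A. \<forall>d\<in>A. smooth_on (chart_map c ` (chart_dom c \<inter> chart_dom d))
        (chart_map d \<circ> chart_inv c))"

definition charts_at :: "('m, 'e) chart set \<Rightarrow> 'm \<Rightarrow> ('m, 'e) chart set"
  where "charts_at A p = {c \<in> A. p \<in> chart_dom c}"


section \<open>Tangent spaces and differentials\<close>

text \<open>A tangent vector at \<open>p\<close> is a family of coordinate vectors, one for each chart around \<open>p\<close>,
  that transform by the derivatives of the coordinate changes. Entries at charts not
  around \<open>p\<close> are normalised to zero.\<close>

type_synonym ('m, 'e) tvec = "('m, 'e) chart \<Rightarrow> 'e"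

definition tangent_space ::
    "('m, 'e::euclidean_space) chart set \<Rightarrow> 'm \<Rightarrow> ('m, 'e) tvec set" where
  "tangent_space A p = {v.
     (\<forall>c\<in>charts_at A p. \<forall>d\<in>charts_at A p.
        v d = frechet_derivative (chart_map d \<circ> chart_inv c) (at (chart_map c p)) (v c)) \<and>
     (\<forall>c. c \<notin> charts_at A p \<longrightarrow> v c = 0)}"

text \<open>The tangent vector at \<open>p\<close> whose coordinates in the chart \<open>c\<close> are \<open>e\<close>.\<close>

definition coord_vec ::
    "('m, 'e::euclidean_space) chart set \<Rightarrow> ('m, 'e) chart \<Rightarrow> 'm \<Rightarrow> 'e \<Rightarrow> ('m, 'e) tvec" where
  "coord_vec A c p e = (\<lambda>d. if d \<in> charts_at A p
     then frechet_derivative (chart_map d \<circ> chart_inv c) (at (chart_map c p)) e else 0)"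

definition smooth_map ::
    "('n::topological_space, 'f::euclidean_space) chart set \<Rightarrow>
     ('m::topological_space, 'e::euclidean_space) chart set \<Rightarrow> ('n \<Rightarrow> 'm) \<Rightarrow> bool" where
  "smooth_map A B h \<longleftrightarrow> continuous_on UNIV h \<and>
     (\<forall>c\<in>A. \<forall>d\<in>B. smooth_on (chart_map c ` (chart_dom c \<inter> h -` chart_dom d))
        (chart_map d \<circ> h \<circ> chart_inv c))"

text \<open>The differential does not depend on the chart \<open>c\<close> chosen around \<open>p\<close>.\<close>

definition differential ::
    "('n, 'f::euclidean_space) chart set \<Rightarrow> ('m, 'e::euclidean_space) chart set \<Rightarrow>
     ('n \<Rightarrow> 'm) \<Rightarrow> 'n \<Rightarrow> ('n, 'f) tvec \<Rightarrow> ('m, 'e) tvec" where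
  "differential A B h p v =
     (let c = (SOME c. c \<in> charts_at A p) in
      (\<lambda>d. if d \<in> charts_at B (h p)
       then frechet_derivative (chart_map d \<circ> h \<circ> chart_inv c) (at (chart_map c p)) (v c)
       else 0))"

definition immersion ::
    "('n::topological_space, 'f::euclidean_space) chart set \<Rightarrow>
     ('m::topological_space, 'e::euclidean_space) chart set \<Rightarrow> ('n \<Rightarrow> 'm) \<Rightarrow> bool" where
  "immersion A B h \<longleftrightarrow> smooth_map A B h \<and>
     (\<forall>p. inj_on (differential A B h p) (tangent_space A p))"


section \<open>Tensor fields\<close>

text \<open>Endomorphisms of a tangent space are extended by zero, so that they form a subspace
  of the type of all functions on \<open>tvec\<close>.\<close>

definition tangent_End ::
    "('m, 'e::euclidean_space) chart set \<Rightarrow> 'm \<Rightarrow> (('m, 'e) tvec \<Rightarrow> ('m, 'e) tvec) set" where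
  "tangent_End A p = {L.
     (\<forall>v\<in>tangent_space A p. L v \<in> tangent_space A p) \<and>
     (\<forall>v\<in>tangent_space A p. \<forall>w\<in>tangent_space A p. L (v + w) = L v + L w) \<and>
     (\<forall>r. \<forall>v\<in>tangent_space A p. L (r *\<^sub>R v) = r *\<^sub>R L v) \<and>
     (\<forall>v. v \<notin> tangent_space A p \<longrightarrow> L v = 0)}"

type_synonym ('m, 'e) endo_field = "'m \<Rightarrow> ('m, 'e) tvec \<Rightarrow> ('m, 'e) tvec"

text \<open>Smoothness of tensor fields is smoothness of their components in all charts of the atlas.\<close>

definition smooth_endo_field ::
    "('m::topological_space, 'e::euclidean_space) chart set \<Rightarrow> 'm set \<Rightarrow>
     ('m, 'e) endo_field \<Rightarrow> bool" where
  "smooth_endo_field A U J \<longleftrightarrow> (\<forall>p\<in>U. J p \<in> tangent_End A p) \<and>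
     (\<forall>c\<in>A. \<forall>e. smooth_on (chart_map c ` (U \<inter> chart_dom c))
        (\<lambda>x. let p = chart_inv c x in J p (coord_vec A c p e) c))"

type_synonym ('m, 'e) bilin_field = "'m \<Rightarrow> ('m, 'e) tvec \<Rightarrow> ('m, 'e) tvec \<Rightarrow> real"

definition bilinear_at ::
    "('m, 'e::euclidean_space) chart set \<Rightarrow> 'm \<Rightarrow>
     (('m, 'e) tvec \<Rightarrow> ('m, 'e) tvec \<Rightarrow> real) \<Rightarrow> bool" where
  "bilinear_at A p b \<longleftrightarrow>
     (\<forall>u\<in>tangent_space A p. \<forall>v\<in>tangent_space A p. \<forall>w\<in>tangent_space A p.
        b (u + v) w = b u w + b v w \<and> b u (v + w) = b u v + b u w) \<and>
     (\<forall>r. \<forall>v\<in>tangent_space A p. \<forall>w\<in>tangent_space A p.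
        b (r *\<^sub>R v) w = r * b v w \<and> b v (r *\<^sub>R w) = r * b v w)"

definition smooth_bilin_field ::
    "('m::topological_space, 'e::euclidean_space) chart set \<Rightarrow> ('m, 'e) bilin_field \<Rightarrow> bool" where
  "smooth_bilin_field A b \<longleftrightarrow> (\<forall>p. bilinear_at A p (b p)) \<and>
     (\<forall>c\<in>A. \<forall>e e'. smooth_on (chart_map c ` chart_dom c)
        (\<lambda>x. let p = chart_inv c x in b p (coord_vec A c p e) (coord_vec A c p e')))"

definition nondegenerate ::
    "('m, 'e::euclidean_space) chart set \<Rightarrow> ('m, 'e) bilin_field \<Rightarrow> bool" where
  "nondegenerate A b \<longleftrightarrow> (\<forall>p. \<forall>v\<in>tangent_space A p.
     (\<forall>w\<in>tangent_space A p. b p v w = 0) \<longrightarrow> v = 0)"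

definition two_form ::
    "('m::topological_space, 'e::euclidean_space) chart set \<Rightarrow> ('m, 'e) bilin_field \<Rightarrow> bool" where
  "two_form A \<omega> \<longleftrightarrow> smooth_bilin_field A \<omega> \<and>
     (\<forall>p. \<forall>v\<in>tangent_space A p. \<forall>w\<in>tangent_space A p. \<omega> p v w = - \<omega> p w v)"

definition pseudo_riemannian_metric ::
    "('m::topological_space, 'e::euclidean_space) chart set \<Rightarrow> ('m, 'e) bilin_field \<Rightarrow> bool" where
  "pseudo_riemannian_metric A g \<longleftrightarrow> smooth_bilin_field A g \<and>
     (\<forall>p. \<forall>v\<in>tangent_space A p. \<forall>w\<in>tangent_space A p. g p v w = g p w v) \<and>
     nondegenerate A g"

definition pullback ::
    "('n, 'f::euclidean_space) chart set \<Rightarrow> ('m, 'e::euclidean_space) chart set \<Rightarrow>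
     ('n \<Rightarrow> 'm) \<Rightarrow> ('m, 'e) bilin_field \<Rightarrow> ('n, 'f) bilin_field" where
  "pullback A B h b p v w = b (h p) (differential A B h p v) (differential A B h p w)"


section \<open>Almost complex and almost pseudo-Hermitian structures\<close>

definition almost_complex_structure ::
    "('m::topological_space, 'e::euclidean_space) chart set \<Rightarrow> ('m, 'e) endo_field \<Rightarrow> bool" where
  "almost_complex_structure A J \<longleftrightarrow> smooth_endo_field A UNIV J \<and>
     (\<forall>p. \<forall>v\<in>tangent_space A p. J p (J p v) = - v)"

definition almost_pseudo_hermitian ::
    "('m::topological_space, 'e::euclidean_space) chart set \<Rightarrow>
     ('m, 'e) bilin_field \<Rightarrow> ('m, 'e) endo_field \<Rightarrow> bool" where
  "almost_pseudo_hermitian A g J \<longleftrightarrow>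
     pseudo_riemannian_metric A g \<and> almost_complex_structure A J \<and>
     (\<forall>p. \<forall>v\<in>tangent_space A p. \<forall>w\<in>tangent_space A p. g p (J p v) (J p w) = g p v w)"


section \<open>Almost quaternionic skew-Hermitian structures\<close>

text \<open>A smooth rank \<open>r\<close> subbundle of the endomorphism bundle, given by its fibres.\<close>

definition End_subbundle ::
    "('m::topological_space, 'e::euclidean_space) chart set \<Rightarrow> nat \<Rightarrow>
     ('m \<Rightarrow> (('m, 'e) tvec \<Rightarrow> ('m, 'e) tvec) set) \<Rightarrow> bool" where
  "End_subbundle A r Q \<longleftrightarrow> (\<forall>p. \<exists>U s. open U \<and> p \<in> U \<and>
     (\<forall>i<r. smooth_endo_field A U (s i)) \<and>
     (\<forall>q\<in>U. Q q = span ((\<lambda>i. s i q) ` {..<r}) \<and> dim (Q q) = r))"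

text \<open>Admissible bases of \<open>Q\<close> over an open set \<open>U\<close>.\<close>

definition admissible_basis ::
    "('m::topological_space, 'e::euclidean_space) chart set \<Rightarrow>
     ('m \<Rightarrow> (('m, 'e) tvec \<Rightarrow> ('m, 'e) tvec) set) \<Rightarrow> 'm set \<Rightarrow>
     ('m, 'e) endo_field \<Rightarrow> ('m, 'e) endo_field \<Rightarrow> ('m, 'e) endo_field \<Rightarrow> bool" where
  "admissible_basis A Q U J1 J2 J3 \<longleftrightarrow> open U \<and>
     (\<forall>J\<in>{J1, J2, J3}. smooth_endo_field A U J \<and>
        (\<forall>p\<in>U. \<forall>v\<in>tangent_space A p. J p (J p v) = - v)) \<and>
     (\<forall>p\<in>U. \<forall>v\<in>tangent_space A p.
        J1 p (J2 p v) = J3 p v \<and> J3 p v = - J2 p (J1 p v)) \<and>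
     (\<forall>p\<in>U. Q p = span {J1 p, J2 p, J3 p})"

definition almost_quaternionic ::
    "('m::topological_space, 'e::euclidean_space) chart set \<Rightarrow>
     ('m \<Rightarrow> (('m, 'e) tvec \<Rightarrow> ('m, 'e) tvec) set) \<Rightarrow> bool" where
  "almost_quaternionic A Q \<longleftrightarrow> End_subbundle A 3 Q \<and>
     (\<forall>p. \<exists>U J1 J2 J3. p \<in> U \<and> admissible_basis A Q U J1 J2 J3)"

definition almost_qsH_manifold ::
    "('m::{t2_space, second_countable_topology}, 'e::euclidean_space) chart set \<Rightarrow>
     ('m \<Rightarrow> (('m, 'e) tvec \<Rightarrow> ('m, 'e) tvec) set) \<Rightarrow> ('m, 'e) bilin_field \<Rightarrow> bool" where
  "almost_qsH_manifold A Q \<omega> \<longleftrightarrow>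
     smooth_atlas A \<and> almost_quaternionic A Q \<and> two_form A \<omega> \<and> nondegenerate A \<omega> \<and>
     (\<forall>U J1 J2 J3. admissible_basis A Q U J1 J2 J3 \<longrightarrow>
        (\<forall>J\<in>{J1, J2, J3}. \<forall>p\<in>U. \<forall>v\<in>tangent_space A p. \<forall>w\<in>tangent_space A p.
           \<omega> p (J p v) (J p w) = \<omega> p v w))"

text \<open>Here \<open>h\<close> is the immersion of the manifold with atlas \<open>B\<close>. As \<open>h\<close> need not be injective, the
  section of \<open>Q\<close> over \<open>U\<close> is related to \<open>J'\<close> only at the points of a neighbourhood \<open>V\<close> of \<open>x\<close>
  upstairs, with \<open>U\<close> containing \<open>h ` V\<close>.\<close>

definition almost_complex_submanifold ::
    "('m::topological_space, 'e::euclidean_space) chart set \<Rightarrow>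
     ('m \<Rightarrow> (('m, 'e) tvec \<Rightarrow> ('m, 'e) tvec) set) \<Rightarrow>
     ('n::{t2_space, second_countable_topology}, 'f::euclidean_space) chart set \<Rightarrow>
     ('n \<Rightarrow> 'm) \<Rightarrow> ('n, 'f) endo_field \<Rightarrow> bool" where
  "almost_complex_submanifold A Q B h J' \<longleftrightarrow>
     smooth_atlas B \<and> immersion B A h \<and> almost_complex_structure B J' \<and>
     (\<forall>x. \<exists>V U J1 J2 J3. \<exists>J\<in>{J1, J2, J3}.
        open V \<and> x \<in> V \<and> h ` V \<subseteq> U \<and> admissible_basis A Q U J1 J2 J3 \<and>
        (\<forall>y\<in>V. let TN = differential B A h y ` tangent_space B y in
           J (h y) ` TN = TN \<and>
           (\<forall>v\<in>tangent_space B y.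
              J (h y) (differential B A h y v) = differential B A h y (J' y v))))"

end

theory Submission
  imports Defs
begin

text \<open>Locally the almost complex structure \<open>J\<close> of the submanifold is the restriction of a member of an
  admissible basis, so \<open>J\<close> preserves the induced form \<open>\<omega>\<close>. With \<open>J\<^sup>2 = -1\<close> and skewness,
  \<open>\<omega>(X, J Y) = \<omega>(J X, J J Y) = \<omega>(Y, J X)\<close>, which is the symmetry of the metric; its invariance under \<open>J\<close> and
  its nondegeneracy are those of \<open>\<omega>\<close>, as \<open>J\<close> is invertible. Smoothness is seen in charts, where the components
  of the metric are polynomial in those of \<open>\<omega>\<close> (composed with the immersion), those of \<open>J\<close> and the first
  derivatives of the immersion.\<close>


section \<open>Calculus of smooth maps\<close>

lemma Ck_on_subset:
  "Ck_on k S f \<Longrightarrow> T \<subseteq> S \<Longrightarrow> Ck_on k T f"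
proof (induction k arbitrary: f)
  case 0
  then show ?case by (metis Ck_on.simps(1) continuous_on_subset)
next
  case (Suc k)
  then show ?case unfolding Ck_on.simps by blast
qed

text \<open>\<open>frechet_derivative\<close> is a choice among all derivatives at the point, and
  near \<open>x\<close> the two functions have the same ones. The equality therefore also covers
  points where neither is differentiable.\<close>

lemma frechet_derivative_cong_open:
  assumes "open S" "x \<in> S" "\<And>y. y \<in> S \<Longrightarrow> f y = g y"
  shows "frechet_derivative f (at x) = frechet_derivative g (at x)"
proof -
  have "(f has_derivative D) (at x) \<longleftrightarrow> (g has_derivative D) (at x)" for D
  proof
    show "(g has_derivative D) (at x)" if "(f has_derivative D) (at x)"
      using has_derivative_transform_within_open[OF that assms] .
    show "(f has_derivative D) (at x)" if "(g has_derivative D) (at x)"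
      using has_derivative_transform_within_open[OF that assms(1,2) assms(3)[symmetric]] .
  qed
  then show ?thesis by (simp add: frechet_derivative_def)
qed

lemma Ck_on_cong:
  assumes "open S" "\<And>x. x \<in> S \<Longrightarrow> f x = g x" "Ck_on k S f"
  shows "Ck_on k S g"
  using assms
proof (induction k arbitrary: f g)
  case 0
  then show ?case
    by (metis Ck_on.simps(1) continuous_on_cong)
next
  case (Suc k)
  have "g differentiable (at x)" if "x \<in> S" for x
  proof -
    have "(f has_derivative frechet_derivative f (at x)) (at x)"
      using Suc.prems that by (simp add: frechet_derivative_works)
    from has_derivative_transform_within_open[OF this \<open>open S\<close> that Suc.prems(2)]
    show ?thesis by (auto simp: differentiable_def)
  qed
  moreover have "Ck_on k S (\<lambda>x. frechet_derivative g (at x) v)" for v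
  proof (rule Suc.IH[OF \<open>open S\<close>])
    show "frechet_derivative f (at x) v = frechet_derivative g (at x) v" if "x \<in> S" for x
      using frechet_derivative_cong_open[OF \<open>open S\<close> that Suc.prems(2)] by simp
    show "Ck_on k S (\<lambda>x. frechet_derivative f (at x) v)"
      using Suc.prems(3) by simp
  qed
  ultimately show ?case by simp
qed

text \<open>Differentiability gives continuity at order 0, and above that the claim descends to each
  directional derivative. Product and chain rule need it, since there undifferentiated factors stand
  next to derivatives.\<close>

lemma Ck_on_SucD: "Ck_on (Suc k) S f \<Longrightarrow> Ck_on k S f"
proof (induction k arbitrary: f)
  case 0
  then show ?case
    by (simp add: continuous_at_imp_continuous_on differentiable_imp_continuous_within)
next
  case (Suc k)
  show ?case
    using Suc.prems unfolding Ck_on.simps(2)[of "Suc k"] Ck_on.simps(2)[of k S f]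
    by (blast intro: Suc.IH)
qed

text \<open>Derivatives are taken at a point of the whole space, so only continuity has to be glued,
  and openness of \<open>T\<close> turns continuity on \<open>T\<close> into continuity at
  \<open>x\<close>.\<close>

lemma Ck_on_local:
  assumes "\<And>x. x \<in> S \<Longrightarrow> \<exists>T. open T \<and> x \<in> T \<and> Ck_on k T f"
  shows "Ck_on k S f"
  using assms
proof (induction k arbitrary: f)
  case 0
  have "isCont f x" if "x \<in> S" for x
    using 0[OF that] by (auto simp: continuous_on_eq_continuous_at)
  then show ?case
    by (simp add: continuous_at_imp_continuous_on)
next
  case (Suc k)
  have "f differentiable (at x)" if "x \<in> S" for x
    using Suc.prems[OF that] unfolding Ck_on.simps by blast
  moreover have "Ck_on k S (\<lambda>x. frechet_derivative f (at x) v)" for v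
  proof (rule Suc.IH)
    show "\<exists>T. open T \<and> x \<in> T \<and> Ck_on k T (\<lambda>x. frechet_derivative f (at x) v)" if "x \<in> S" for x
      using Suc.prems[OF that] unfolding Ck_on.simps by blast
  qed
  ultimately show ?case by simp
qed

section \<open>Closure of \<open>Ck_on\<close> under sums, bilinear products and composition\<close>

lemma Ck_on_const [simp]: "Ck_on k S (\<lambda>_. c)"
  by (induction k arbitrary: c) simp_all

lemma Ck_on_add:
  assumes "open S" "Ck_on k S f" "Ck_on k S g"
  shows "Ck_on k S (\<lambda>x. f x + g x)"
  using assms
proof (induction k arbitrary: f g)
  case 0
  then show ?case by (simp add: continuous_on_add)
next
  case (Suc k)
  have "Ck_on k S (\<lambda>x. frechet_derivative (\<lambda>x. f x + g x) (at x) v)" for v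
  proof (rule Ck_on_cong[OF \<open>open S\<close>])
    show "Ck_on k S (\<lambda>x. frechet_derivative f (at x) v + frechet_derivative g (at x) v)"
      using Suc by simp
    show "frechet_derivative f (at x) v + frechet_derivative g (at x) v =
        frechet_derivative (\<lambda>x. f x + g x) (at x) v" if "x \<in> S" for x
      using Suc.prems that
      by (auto simp: frechet_derivative_works
          intro!: frechet_derivative_at[OF has_derivative_add, THEN fun_cong])
  qed
  with Suc.prems show ?case by simp
qed

lemma Ck_on_sum:
  assumes "open S" "\<And>i. i \<in> I \<Longrightarrow> Ck_on k S (f i)"
  shows "Ck_on k S (\<lambda>x. \<Sum>i\<in>I. f i x)"
  using assms(2) by (induction I rule: infinite_finite_induct) (simp_all add: Ck_on_add assms(1))

text \<open>By the product rule the derivative is a sum of two terms of the same bilinear shape, so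
  the induction keeps both \<open>f\<close> and \<open>g\<close> arbitrary.\<close>

lemma Ck_on_bilinear:
  assumes "bounded_bilinear m" "open S" "Ck_on k S f" "Ck_on k S g"
  shows "Ck_on k S (\<lambda>x. m (f x) (g x))"
  using assms
proof (induction k arbitrary: f g)
  case 0
  then show ?case by (simp add: bounded_bilinear.continuous_on)
next
  case (Suc k)
  have D: "((\<lambda>x. m (f x) (g x)) has_derivative
      (\<lambda>v. m (f x) (frechet_derivative g (at x) v) + m (frechet_derivative f (at x) v) (g x)))
      (at x)" if "x \<in> S" for x
    using Suc.prems that
    by (auto simp: frechet_derivative_works intro!: bounded_bilinear.FDERIV)
  have "Ck_on k S (\<lambda>x. frechet_derivative (\<lambda>x. m (f x) (g x)) (at x) v)" for v
  proof (rule Ck_on_cong[OF \<open>open S\<close>])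
    show "Ck_on k S (\<lambda>x. m (f x) (frechet_derivative g (at x) v) +
        m (frechet_derivative f (at x) v) (g x))"
      using Suc.prems Ck_on_SucD[OF Suc.prems(3)] Ck_on_SucD[OF Suc.prems(4)]
      by (intro Ck_on_add Suc.IH) auto
    show "m (f x) (frechet_derivative g (at x) v) + m (frechet_derivative f (at x) v) (g x) =
        frechet_derivative (\<lambda>x. m (f x) (g x)) (at x) v" if "x \<in> S" for x
      by (rule fun_cong[OF frechet_derivative_at[OF D[OF that]]])
  qed
  with D show ?case unfolding Ck_on.simps differentiable_def by blast
qed

text \<open>\<open>Ck_on\<close> controls derivatives in fixed directions only. This expansion
  reduces a direction that moves with the point to the fixed basis directions.\<close>

lemma linear_eq_sum_Basis:
  fixes L :: "'a::euclidean_space \<Rightarrow> 'b::real_vector"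
  assumes "linear L"
  shows "L u = (\<Sum>b\<in>Basis. (u \<bullet> b) *\<^sub>R L b)"
  by (metis (no_types, lifting) assms euclidean_representation linear_scale linear_sum sum.cong)

lemma linear_frechet_derivative_at:
  "f differentiable (at x) \<Longrightarrow> linear (frechet_derivative f (at x))"
  by (simp add: frechet_derivative_works has_derivative_linear)

text \<open>The chain rule applies the derivative of \<open>g\<close> at \<open>f x\<close> to a
  vector depending on \<open>x\<close>. Expanded in a basis, this is a sum of products of components
  of the derivative of \<open>f\<close> with partial derivatives of \<open>g\<close> composed with
  \<open>f\<close>. The induction hypothesis handles the latter, as it holds for arbitrary
  \<open>g\<close>.\<close>

lemma Ck_on_compose:
  fixes f :: "'a::euclidean_space \<Rightarrow> 'b::euclidean_space"
  assumes "open S" "open T" "f ` S \<subseteq> T" "Ck_on k S f" "Ck_on k T g"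
  shows "Ck_on k S (g \<circ> f)"
  using assms
proof (induction k arbitrary: g)
  case 0
  then show ?case 
    by (metis Ck_on.simps(1) continuous_on_compose continuous_on_subset)
next
  case (Suc k)
  let ?Df = "\<lambda>x. frechet_derivative f (at x)" and ?Dg = "\<lambda>x. frechet_derivative g (at x)"
  have D: "((g \<circ> f) has_derivative (?Dg (f x) \<circ> ?Df x)) (at x)"
    and lin: "linear (?Dg (f x))" if "x \<in> S" for x
  proof -
    have "f differentiable (at x)" "g differentiable (at (f x))"
      using Suc.prems that by auto
    then show "((g \<circ> f) has_derivative (?Dg (f x) \<circ> ?Df x)) (at x)" "linear (?Dg (f x))"
      by (simp_all add: frechet_derivative_works diff_chain_at has_derivative_linear)
  qed
  have "Ck_on k S (\<lambda>x. frechet_derivative (g \<circ> f) (at x) v)" for v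
  proof (rule Ck_on_cong[OF \<open>open S\<close>])
    show "Ck_on k S (\<lambda>x. \<Sum>b\<in>Basis. (?Df x v \<bullet> b) *\<^sub>R ((\<lambda>y. ?Dg y b) \<circ> f) x)"
      using Suc.prems Ck_on_SucD[OF Suc.prems(4)]
      by (intro Ck_on_sum Ck_on_bilinear[OF bounded_bilinear_scaleR]
          Ck_on_bilinear[OF bounded_bilinear_inner] Suc.IH) auto
    show "(\<Sum>b\<in>Basis. (?Df x v \<bullet> b) *\<^sub>R ((\<lambda>y. ?Dg y b) \<circ> f) x) =
        frechet_derivative (g \<circ> f) (at x) v" if "x \<in> S" for x
      using linear_eq_sum_Basis[OF lin[OF that], of "?Df x v"]
        fun_cong[OF frechet_derivative_at[OF D[OF that]], of v]
      by simp
  qed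
  with D show ?case unfolding Ck_on.simps differentiable_def by blast
qed

section \<open>Passage from every finite order to smoothness\<close>

lemma smooth_on_subset: "smooth_on S f \<Longrightarrow> T \<subseteq> S \<Longrightarrow> smooth_on T f"
  unfolding smooth_on_def using Ck_on_subset by blast

lemma smooth_on_cong:
  "open S \<Longrightarrow> (\<And>x. x \<in> S \<Longrightarrow> f x = g x) \<Longrightarrow> smooth_on S f \<Longrightarrow> smooth_on S g"
  unfolding smooth_on_def using Ck_on_cong by metis

lemma smooth_on_local:
  assumes "\<And>x. x \<in> S \<Longrightarrow> \<exists>T. open T \<and> x \<in> T \<and> smooth_on T f"
  shows "smooth_on S f"
  using assms unfolding smooth_on_def by (meson Ck_on_local)

lemma smooth_on_const [simp]: "smooth_on S (\<lambda>_. c)"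
  by (simp add: smooth_on_def)

lemma smooth_on_sum:
  "open S \<Longrightarrow> (\<And>i. i \<in> I \<Longrightarrow> smooth_on S (f i)) \<Longrightarrow> smooth_on S (\<lambda>x. \<Sum>i\<in>I. f i x)"
  by (simp add: smooth_on_def Ck_on_sum)

lemma smooth_on_bilinear:
  "bounded_bilinear m \<Longrightarrow> open S \<Longrightarrow> smooth_on S f \<Longrightarrow> smooth_on S g \<Longrightarrow>
    smooth_on S (\<lambda>x. m (f x) (g x))"
  by (simp add: smooth_on_def Ck_on_bilinear)

lemmas smooth_on_inner = smooth_on_bilinear[OF bounded_bilinear_inner]
lemmas smooth_on_scaleR = smooth_on_bilinear[OF bounded_bilinear_scaleR]
lemmas smooth_on_mult = smooth_on_bilinear[OF bounded_bilinear_mult]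

lemma smooth_on_compose:
  fixes f :: "'a::euclidean_space \<Rightarrow> 'b::euclidean_space"
  shows "open S \<Longrightarrow> open T \<Longrightarrow> f ` S \<subseteq> T \<Longrightarrow> smooth_on S f \<Longrightarrow> smooth_on T g \<Longrightarrow> smooth_on S (g \<circ> f)"
  unfolding smooth_on_def by (meson Ck_on_compose)

lemma smooth_on_differentiable: "smooth_on S f \<Longrightarrow> x \<in> S \<Longrightarrow> f differentiable (at x)"
  unfolding smooth_on_def by (drule spec[of _ "Suc 0"]) simp

lemma smooth_on_frechet_derivative:
  "smooth_on S f \<Longrightarrow> smooth_on S (\<lambda>x. frechet_derivative f (at x) v)"
  unfolding smooth_on_def
proof
  show "Ck_on k S (\<lambda>x. frechet_derivative f (at x) v)" if "\<forall>k. Ck_on k S f" for k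
    using that[rule_format, of "Suc k"] by simp
qed

lemma smooth_on_frechet_derivative_apply:
  fixes f u :: "'a::euclidean_space \<Rightarrow> _"
  assumes "open S" "smooth_on S f" "smooth_on S u"
  shows "smooth_on S (\<lambda>x. frechet_derivative f (at x) (u x))"
proof (rule smooth_on_cong[OF \<open>open S\<close>])
  show "smooth_on S (\<lambda>x. \<Sum>b\<in>Basis. (u x \<bullet> b) *\<^sub>R frechet_derivative f (at x) b)"
    using assms
    by (intro smooth_on_sum smooth_on_scaleR smooth_on_inner smooth_on_frechet_derivative) auto
  show "(\<Sum>b\<in>Basis. (u x \<bullet> b) *\<^sub>R frechet_derivative f (at x) b) =
      frechet_derivative f (at x) (u x)" if "x \<in> S" for x
    using linear_eq_sum_Basis[OF linear_frechet_derivative_at, symmetric]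
      smooth_on_differentiable[OF assms(2) that] by blast
qed


section \<open>Tangent vectors in charts\<close>

lemma is_chart_inv:
  assumes "is_chart c" "p \<in> chart_dom c"
  shows "chart_inv c (chart_map c p) = p"
  using assms by (auto simp: is_chart_def homeomorphism_def)

text \<open>A homeomorphism is open onto its image, and the image of a chart is itself open in the
  Euclidean space.\<close>

lemma is_chart_open_image:
  assumes "is_chart c" "open W"
  shows "open (chart_map c ` (chart_dom c \<inter> W))"
proof -
  have "openin (top_of_set (chart_map c ` chart_dom c)) (chart_map c ` (chart_dom c \<inter> W))"
    using assms by (intro homeomorphism_imp_open_map[of "chart_dom c" _ _ "chart_inv c"])
      (auto simp: is_chart_def)
  with assms show ?thesis
    by (auto simp: is_chart_def intro: openin_open_trans)
qed

lemma smooth_atlas_chart: "smooth_atlas A \<Longrightarrow> c \<in> charts_at A p \<Longrightarrow> is_chart c \<and> open (chart_dom c)"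
  by (auto simp: smooth_atlas_def charts_at_def is_chart_def)

lemma smooth_atlas_charts_at: "smooth_atlas A \<Longrightarrow> \<exists>c. c \<in> charts_at A p"
  unfolding smooth_atlas_def charts_at_def by blast

text \<open>For the identity, the chart condition on smooth maps is the compatibility of the atlas.
  Coordinate changes thus become a special case of chart representatives of maps.\<close>

lemma smooth_map_id: "smooth_atlas A \<Longrightarrow> smooth_map A A (\<lambda>x. x)"
  by (auto simp: smooth_atlas_def smooth_map_def comp_def vimage_def)

lemma open_chart_overlap:
  assumes "smooth_atlas A" "smooth_atlas B" "smooth_map A B h"
    and "c \<in> charts_at A p" "d \<in> charts_at B (h p)"
  shows "open (chart_map c ` (chart_dom c \<inter> h -` chart_dom d))"
  using assms smooth_atlas_chart[OF assms(1,4)] smooth_atlas_chart[OF assms(2,5)]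
  by (auto intro!: is_chart_open_image simp: smooth_map_def open_vimage)

lemma smooth_map_differentiable:
  assumes "smooth_map A B h" "c \<in> charts_at A p" "d \<in> charts_at B (h p)"
  shows "(chart_map d \<circ> h \<circ> chart_inv c) differentiable (at (chart_map c p))"
  using assms
  by (intro smooth_on_differentiable[of "chart_map c ` (chart_dom c \<inter> h -` chart_dom d)"])
     (auto simp: smooth_map_def charts_at_def)

text \<open>Taking one of the two maps to be the identity gives the change of chart in the source or in
  the target.\<close>

lemma chart_rep_chain:
  assumes "smooth_atlas A" "smooth_atlas B" "smooth_atlas C"
    and "smooth_map A B h" "smooth_map B C l"
    and c: "c \<in> charts_at A p" and d: "d \<in> charts_at B (h p)" and e: "e \<in> charts_at C (l (h p))"
  shows "frechet_derivative (chart_map e \<circ> l \<circ> chart_inv d) (at (chart_map d (h p)))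
           (frechet_derivative (chart_map d \<circ> h \<circ> chart_inv c) (at (chart_map c p)) v) =
         frechet_derivative (chart_map e \<circ> (\<lambda>x. l (h x)) \<circ> chart_inv c) (at (chart_map c p)) v"
proof -
  let ?F = "chart_map d \<circ> h \<circ> chart_inv c" and ?G = "chart_map e \<circ> l \<circ> chart_inv d"
  let ?S = "chart_map c ` (chart_dom c \<inter> h -` chart_dom d)"
  note inv = is_chart_inv[of c] is_chart_inv[of d]
  have cd: "is_chart c" "is_chart d" "p \<in> chart_dom c" "h p \<in> chart_dom d"
    using smooth_atlas_chart assms by (auto simp: charts_at_def smooth_atlas_def)
  have F: "?F (chart_map c p) = chart_map d (h p)"
    using cd by (simp add: inv)
  have "(?G \<circ> ?F has_derivative frechet_derivative ?G (at (chart_map d (h p))) \<circ>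
      frechet_derivative ?F (at (chart_map c p))) (at (chart_map c p))"
    using smooth_map_differentiable[OF assms(4) c d] smooth_map_differentiable[OF assms(5) d e] F
    by (intro diff_chain_at) (simp_all add: frechet_derivative_works)
  then have "frechet_derivative (?G \<circ> ?F) (at (chart_map c p)) =
      frechet_derivative ?G (at (chart_map d (h p))) \<circ> frechet_derivative ?F (at (chart_map c p))"
    by (metis frechet_derivative_at)
  \<comment> \<open>The inner \<open>chart_inv d\<close> and \<open>chart_map d\<close> cancel only
    where \<open>h\<close> lands in the domain of \<open>d\<close>, that is on the open set
    \<open>?S\<close>.\<close>
  moreover have "frechet_derivative (?G \<circ> ?F) (at (chart_map c p)) =
      frechet_derivative (chart_map e \<circ> (\<lambda>x. l (h x)) \<circ> chart_inv c) (at (chart_map c p))"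
    using open_chart_overlap[OF assms(1,2,4) c d] cd
    by (intro frechet_derivative_cong_open[of ?S]) (auto simp: inv)
  ultimately show ?thesis by (metis comp_apply)
qed

section \<open>Tangent spaces and coordinate vectors\<close>

lemma transition_eq: "chart_map d \<circ> chart_inv c = chart_map d \<circ> (\<lambda>x. x) \<circ> chart_inv c"
  by (simp add: comp_def)

text \<open>The transformation law is turned around so that rewriting removes derivatives; in the
  direction of the definition it would loop.\<close>

lemma tangent_space_iff:
  "v \<in> tangent_space A p \<longleftrightarrow>
    (\<forall>c\<in>charts_at A p. \<forall>d\<in>charts_at A p.
      frechet_derivative (chart_map d \<circ> chart_inv c) (at (chart_map c p)) (v c) = v d) \<and>
    (\<forall>c. c \<notin> charts_at A p \<longrightarrow> v c = 0)"
  unfolding tangent_space_def mem_Collect_eq by metis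

lemma tangent_space_transition:
  assumes "v \<in> tangent_space A p" "c \<in> charts_at A p" "d \<in> charts_at A p"
  shows "frechet_derivative (chart_map d \<circ> (\<lambda>x. x) \<circ> chart_inv c) (at (chart_map c p)) (v c) = v d"
  using assms by (simp add: tangent_space_iff flip: transition_eq)

lemma transition_linear:
  assumes "smooth_atlas A" "c \<in> charts_at A p" "d \<in> charts_at A p"
  shows "linear (frechet_derivative (chart_map d \<circ> chart_inv c) (at (chart_map c p)))"
  unfolding transition_eq
  using assms smooth_map_id smooth_map_differentiable[of A A "\<lambda>x. x" c p d]
  by (blast intro: linear_frechet_derivative_at)

lemma subspace_tangent_space:
  assumes "smooth_atlas A"
  shows "subspace (tangent_space A p)"
  unfolding subspace_def
  using transition_linear[OF assms]
  by (auto simp: tangent_space_iff scaleR_fun_def zero_fun_def plus_fun_def linear_add linear_0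
      linear_scale)

text \<open>The transformation law is the cocycle identity for coordinate changes: the chain rule
  with both maps equal to the identity.\<close>

lemma coord_vec_tangent_space:
  assumes "smooth_atlas A" "c \<in> charts_at A p"
  shows "coord_vec A c p e \<in> tangent_space A p"
  using chart_rep_chain[OF assms(1) assms(1) assms(1) smooth_map_id smooth_map_id assms(2)] assms
  by (auto simp: tangent_space_iff coord_vec_def transition_eq)

lemma coord_vec_linear:
  assumes "smooth_atlas A" "c \<in> charts_at A p"
  shows "linear (coord_vec A c p)"
  using transition_linear[OF assms]
  by (intro linearI)
     (auto simp: coord_vec_def fun_eq_iff scaleR_fun_def linear_add linear_scale)

lemma coord_vec_self:
  assumes "smooth_atlas A" "c \<in> charts_at A p"
  shows "coord_vec A c p e c = e"
proof -
  have c: "is_chart c" "p \<in> chart_dom c" using assms by (auto simp: smooth_atlas_def charts_at_def)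
  then have "frechet_derivative (chart_map c \<circ> chart_inv c) (at (chart_map c p)) =
      frechet_derivative (\<lambda>x. x) (at (chart_map c p))"
    using is_chart_open_image[OF c(1) open_UNIV]
    by (intro frechet_derivative_cong_open[of "chart_map c ` chart_dom c"])
       (auto simp: is_chart_inv)
  then show ?thesis using assms by (simp add: coord_vec_def)
qed

text \<open>This replaces the arbitrarily chosen chart in \<open>differential\<close> by any chart
  \<open>c\<close>, and describes the result through a single target chart \<open>d\<close>. Later
  facts about differentials are read off from it.\<close>

lemma differential_eq_coord_vec:
  assumes A: "smooth_atlas A" and B: "smooth_atlas B" and h: "smooth_map A B h"
    and v: "v \<in> tangent_space A p" and c: "c \<in> charts_at A p" and d: "d \<in> charts_at B (h p)"
  shows "differential A B h p v = coord_vec B d (h p)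
    (frechet_derivative (chart_map d \<circ> h \<circ> chart_inv c) (at (chart_map c p)) (v c))"
proof
  fix e
  define c0 where "c0 = (SOME c. c \<in> charts_at A p)"
  have c0: "c0 \<in> charts_at A p" unfolding c0_def using c by (rule someI)
  show "differential A B h p v e = coord_vec B d (h p)
    (frechet_derivative (chart_map d \<circ> h \<circ> chart_inv c) (at (chart_map c p)) (v c)) e"
  proof (cases "e \<in> charts_at B (h p)")
    case True
    then show ?thesis
      \<comment> \<open>The first instance changes the source chart from \<open>c0\<close> to
        \<open>c\<close>, the second the target chart from \<open>d\<close> to \<open>e\<close>; the
        third fact identifies the transported \<open>v c0\<close> with \<open>v c\<close>.\<close>
      using chart_rep_chain[OF A A B smooth_map_id[OF A] h c0 c, of e "v c0"]
        chart_rep_chain[OF A B B h smooth_map_id[OF B] c d, of e "v c"]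
        tangent_space_transition[OF v c0 c]
      by (simp add: differential_def coord_vec_def Let_def transition_eq flip: c0_def)
  qed (simp add: differential_def coord_vec_def Let_def)
qed

lemma differential_tangent_space:
  assumes "smooth_atlas A" "smooth_atlas B" "smooth_map A B h" "v \<in> tangent_space A p"
  shows "differential A B h p v \<in> tangent_space B (h p)"
  using assms smooth_atlas_charts_at differential_eq_coord_vec coord_vec_tangent_space by metis

lemma differential_linear:
  assumes A: "smooth_atlas A" and B: "smooth_atlas B" and h: "smooth_map A B h"
    and v: "v \<in> tangent_space A p" and w: "w \<in> tangent_space A p"
  shows "differential A B h p (v + w) = differential A B h p v + differential A B h p w"
    and "differential A B h p (r *\<^sub>R v) = r *\<^sub>R differential A B h p v"
proof -
  obtain c d where c: "c \<in> charts_at A p" and d: "d \<in> charts_at B (h p)"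
    using smooth_atlas_charts_at A B by metis
  note eq = differential_eq_coord_vec[OF A B h _ c d]
  note lin = coord_vec_linear[OF B d]
    linear_frechet_derivative_at[OF smooth_map_differentiable[OF h c d]]
  have "v + w \<in> tangent_space A p" "r *\<^sub>R v \<in> tangent_space A p"
    using subspace_tangent_space[OF A] v w by (auto simp: subspace_def)
  then show "differential A B h p (v + w) = differential A B h p v + differential A B h p w"
    "differential A B h p (r *\<^sub>R v) = r *\<^sub>R differential A B h p v"
    using v w lin by (simp_all add: eq linear_add linear_scale scaleR_fun_def)
qed

text \<open>\<open>bilinear_at\<close> speaks of tangent vectors only, so linearity is first
  transferred to the coordinates \<open>x\<close> and \<open>y\<close> via \<open>coord_vec\<close>.
  The sum then separates the components of the form from those of its arguments.\<close>

lemma bilinear_at_sum_Basis: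
  fixes A :: "('m::{t2_space, second_countable_topology}, 'e::euclidean_space) chart set"
  assumes A: "smooth_atlas A" and c: "c \<in> charts_at A p" and b: "bilinear_at A p b"
  shows "b (coord_vec A c p x) (coord_vec A c p y) =
    (\<Sum>i\<in>Basis. \<Sum>j\<in>Basis. (x \<bullet> i) * (y \<bullet> j) * b (coord_vec A c p i) (coord_vec A c p j))"
proof -
  let ?e = "coord_vec A c p"
  note lin = coord_vec_linear[OF A c] and T = coord_vec_tangent_space[OF A c]
  have l: "linear (\<lambda>x. b (?e x) w)" if "w \<in> tangent_space A p" for w
    using b T that lin
    by (intro linearI) (auto simp: bilinear_at_def linear_add linear_scale)
  have r: "linear (\<lambda>x. b w (?e x))" if "w \<in> tangent_space A p" for w
    using b T that lin
    by (intro linearI) (auto simp: bilinear_at_def linear_add linear_scale)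
  have "b (?e x) (?e y) = (\<Sum>i\<in>Basis. (x \<bullet> i) *\<^sub>R b (?e i) (?e y))"
    using linear_eq_sum_Basis[OF l[OF T]] .
  also have "\<dots> = (\<Sum>i\<in>Basis. (x \<bullet> i) *\<^sub>R (\<Sum>j\<in>Basis. (y \<bullet> j) *\<^sub>R b (?e i) (?e j)))"
    using linear_eq_sum_Basis[OF r[OF T], of _ y] by simp
  finally show ?thesis
    by (simp add: sum_distrib_left mult.assoc)
qed


section \<open>The induced pseudo-Hermitian metric\<close>

text \<open>Neither symmetry of \<open>b\<close> nor \<open>J\<close> squaring to -1 enters here:
  smoothness and bilinearity hold for any smooth form twisted by a smooth endomorphism
  field.\<close>

lemma smooth_bilin_field_pullback_endo:
  fixes A :: "('m::{t2_space, second_countable_topology}, 'e::euclidean_space) chart set"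
    and B :: "('n::{t2_space, second_countable_topology}, 'f::euclidean_space) chart set"
  assumes A: "smooth_atlas A" and B: "smooth_atlas B" and h: "smooth_map B A h"
    and b: "smooth_bilin_field A b" and J: "smooth_endo_field B UNIV J"
  shows "smooth_bilin_field B (\<lambda>x X Y. pullback B A h b x X (J x Y))"
  unfolding smooth_bilin_field_def
proof (intro conjI allI ballI)
  have JT: "J p \<in> tangent_End B p" for p using J by (simp add: smooth_endo_field_def)
  show "bilinear_at B p (\<lambda>X Y. pullback B A h b p X (J p Y))" for p
  proof -
    have "bilinear_at A (h p) (b (h p))" using b by (simp add: smooth_bilin_field_def)
    moreover have "J p v \<in> tangent_space B p" "J p (r *\<^sub>R v) = r *\<^sub>R J p v"
      if "v \<in> tangent_space B p" for v r
      using JT[of p] that by (simp_all add: tangent_End_def)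
    moreover have "J p (v + w) = J p v + J p w"
      if "v \<in> tangent_space B p" "w \<in> tangent_space B p" for v w
      using JT[of p] that by (simp add: tangent_End_def)
    ultimately show ?thesis
      unfolding bilinear_at_def pullback_def
      by (simp add: differential_tangent_space[OF B A h] differential_linear[OF B A h])
  qed
  fix c e e' assume cB: "c \<in> B"
  let ?G = "\<lambda>x. let p = chart_inv c x in
    pullback B A h b p (coord_vec B c p e) (J p (coord_vec B c p e'))"
  show "smooth_on (chart_map c ` chart_dom c) ?G"
  \<comment> \<open>The domain of \<open>c\<close> may not be mapped into a single chart of the
    ambient manifold, so a chart \<open>d\<close> is chosen around the image of each point.\<close>
  proof (rule smooth_on_local)
    fix x0 assume "x0 \<in> chart_map c ` chart_dom c"
    then obtain p0 where p0: "p0 \<in> chart_dom c" "x0 = chart_map c p0" by auto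
    then have c0: "c \<in> charts_at B p0" using cB by (simp add: charts_at_def)
    obtain d where d0: "d \<in> charts_at A (h p0)" using smooth_atlas_charts_at[OF A] by metis
    then have dA: "d \<in> A" by (simp add: charts_at_def)
    define S where "S = chart_map c ` (chart_dom c \<inter> h -` chart_dom d)"
    \<comment> \<open>\<open>F\<close> represents \<open>h\<close> in the charts, \<open>u\<close>
      gives the coordinates of \<open>J\<close> applied to the basis field of \<open>e'\<close>, and
      \<open>b'\<close> the components of \<open>b\<close> in \<open>d\<close>.\<close>
    define F where "F = chart_map d \<circ> h \<circ> chart_inv c"
    define u where "u x = J (chart_inv c x) (coord_vec B c (chart_inv c x) e') c" for x
    define b' where "b' i j y = b (chart_inv d y) (coord_vec A d (chart_inv d y) i)
      (coord_vec A d (chart_inv d y) j)" for i j y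
    have chart: "is_chart c" "is_chart d" "open (chart_map d ` chart_dom d)"
      using A B cB dA by (auto simp: smooth_atlas_def is_chart_def)
    have S: "open S" unfolding S_def by (rule open_chart_overlap[OF B A h c0 d0])
    have "x0 \<in> S" using p0 d0 by (auto simp: S_def charts_at_def)
    have F: "smooth_on S F"
      using h cB dA by (simp add: smooth_map_def S_def F_def)
    have u: "smooth_on S u"
    proof (rule smooth_on_subset)
      show "smooth_on (chart_map c ` (UNIV \<inter> chart_dom c)) u"
        using J cB unfolding smooth_endo_field_def u_def Let_def by blast
    qed (auto simp: S_def)
    have FS: "F ` S \<subseteq> chart_map d ` chart_dom d"
      using chart by (auto simp: F_def S_def is_chart_inv)
    have b': "smooth_on S (b' i j \<circ> F)" for i j
      using b dA FS S F chart unfolding smooth_bilin_field_def b'_def Let_def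
      by (intro smooth_on_compose[of S "chart_map d ` chart_dom d"]) blast+
    have "smooth_on S ?G"
    proof (rule smooth_on_cong[OF S])
      show "smooth_on S (\<lambda>x. \<Sum>i\<in>Basis. \<Sum>j\<in>Basis. (frechet_derivative F (at x) e \<bullet> i) *
          (frechet_derivative F (at x) (u x) \<bullet> j) * (b' i j \<circ> F) x)"
        by (intro smooth_on_sum smooth_on_mult smooth_on_inner smooth_on_frechet_derivative_apply
            smooth_on_const S F u b')
      fix x assume "x \<in> S"
      then obtain p where p: "p \<in> chart_dom c" "h p \<in> chart_dom d" "x = chart_map c p"
        by (auto simp: S_def)
      then have c: "c \<in> charts_at B p" and d: "d \<in> charts_at A (h p)"
        using cB dA by (auto simp: charts_at_def)
      have px: "chart_inv c x = p" "chart_inv d (F x) = h p"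
        using p chart by (simp_all add: F_def is_chart_inv)
      have T: "coord_vec B c p e \<in> tangent_space B p" for e
        using coord_vec_tangent_space[OF B c] .
      then have JT': "J p (coord_vec B c p e') \<in> tangent_space B p"
        using JT[of p] by (simp add: tangent_End_def)
      have "bilinear_at A (h p) (b (h p))" using b by (simp add: smooth_bilin_field_def)
      note sum = bilinear_at_sum_Basis[OF A d this,
          of "frechet_derivative F (at x) e" "frechet_derivative F (at x) (u x)"]
      \<comment> \<open>Both arguments are pushed forward in coordinates: those of the first vector
        are \<open>e\<close> by \<open>coord_vec_self\<close>, those of the second are
        \<open>u x\<close>.\<close>
      have "?G x = b (h p) (coord_vec A d (h p) (frechet_derivative F (at x) e))
          (coord_vec A d (h p) (frechet_derivative F (at x) (u x)))"
        by (simp add: px pullback_def differential_eq_coord_vec[OF B A h T c d]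
            differential_eq_coord_vec[OF B A h JT' c d] coord_vec_self[OF B c] u_def
            flip: F_def p(3))
      then show "(\<Sum>i\<in>Basis. \<Sum>j\<in>Basis. (frechet_derivative F (at x) e \<bullet> i) *
          (frechet_derivative F (at x) (u x) \<bullet> j) * (b' i j \<circ> F) x) = ?G x"
        unfolding sum by (simp add: b'_def px)
    qed
    with S \<open>x0 \<in> S\<close> show "\<exists>T. open T \<and> x0 \<in> T \<and> smooth_on T ?G" by blast
  qed
qed

theorem proposition2p20:
  fixes A :: "('m::{t2_space, second_countable_topology}, 'e::euclidean_space) chart set"
    and Q :: "'m \<Rightarrow> (('m, 'e) tvec \<Rightarrow> ('m, 'e) tvec) set"
    and \<omega> :: "('m, 'e) bilin_field"
    and B :: "('n::{t2_space, second_countable_topology}, 'f::euclidean_space) chart set"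
    and \<iota> :: "'n \<Rightarrow> 'm"
    and J :: "('n, 'f) endo_field"
    and n k :: nat
  assumes "n > 1" and "DIM('e) = 4 * n"
    and "almost_qsH_manifold A Q \<omega>"
    and "DIM('f) = 2 * k"
    and "almost_complex_submanifold A Q B \<iota> J"
    and "nondegenerate B (pullback B A \<iota> \<omega>)"
  shows "almost_pseudo_hermitian B (\<lambda>x X Y. pullback B A \<iota> \<omega> x X (J x Y)) J"
proof -
  define g where "g = (\<lambda>x X Y. pullback B A \<iota> \<omega> x X (J x Y))"
  have A: "smooth_atlas A" and w: "two_form A \<omega>"
    and B: "smooth_atlas B" and h: "smooth_map B A \<iota>" and J: "almost_complex_structure B J"
    using assms(3,5)
    by (auto simp: almost_qsH_manifold_def almost_complex_submanifold_def immersion_def)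
  have JT: "J p v \<in> tangent_space B p" and JJ: "J p (J p v) = - v"
    if "v \<in> tangent_space B p" for p v
    using J that by (auto simp: almost_complex_structure_def smooth_endo_field_def tangent_End_def)
  have w_bilin: "bilinear_at A q (\<omega> q)" for q
    using w by (simp add: two_form_def smooth_bilin_field_def)
  have w_skew: "\<omega> q v u = - \<omega> q u v"
    if "v \<in> tangent_space A q" "u \<in> tangent_space A q" for q v u
    using w that unfolding two_form_def by blast
  note dT = differential_tangent_space[OF B A h]
  \<comment> \<open>The differential intertwines \<open>J\<close> with a member \<open>I\<close> of
    an admissible basis near \<open>p\<close>, and \<open>\<omega>\<close> is invariant under
    \<open>I\<close>.\<close>
  have inv: "\<omega> (\<iota> p) (differential B A \<iota> p (J p v)) (differential B A \<iota> p (J p u)) =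
      \<omega> (\<iota> p) (differential B A \<iota> p v) (differential B A \<iota> p u)"
    if "v \<in> tangent_space B p" "u \<in> tangent_space B p" for p v u
  proof -
    obtain V U J1 J2 J3 I where I: "I \<in> {J1, J2, J3}" "p \<in> V" "\<iota> ` V \<subseteq> U"
        "admissible_basis A Q U J1 J2 J3"
      and loc: "\<forall>y\<in>V. let TN = differential B A \<iota> y ` tangent_space B y in
           I (\<iota> y) ` TN = TN \<and>
           (\<forall>v\<in>tangent_space B y.
              I (\<iota> y) (differential B A \<iota> y v) = differential B A \<iota> y (J y v))"
      using conjunct2[OF conjunct2[OF conjunct2[OF assms(5)[unfolded almost_complex_submanifold_def]]],
          rule_format, of p]
      by (elim exE bexE conjE)
    have comm: "I (\<iota> p) (differential B A \<iota> p x) = differential B A \<iota> p (J p x)"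
      if "x \<in> tangent_space B p" for x
      using bspec[OF loc I(2)] that unfolding Let_def by blast
    have "\<forall>U J1 J2 J3. admissible_basis A Q U J1 J2 J3 \<longrightarrow>
        (\<forall>J\<in>{J1, J2, J3}. \<forall>p\<in>U. \<forall>v\<in>tangent_space A p. \<forall>w\<in>tangent_space A p.
           \<omega> p (J p v) (J p w) = \<omega> p v w)"
      using assms(3) unfolding almost_qsH_manifold_def by (elim conjE)
    from this[rule_format, OF I(4,1)]
    have "\<omega> (\<iota> p) (I (\<iota> p) x) (I (\<iota> p) y) = \<omega> (\<iota> p) x y"
      if "x \<in> tangent_space A (\<iota> p)" "y \<in> tangent_space A (\<iota> p)" for x y
      using I(2,3) that by blast
    from this[OF dT dT, OF that] show ?thesis
      by (simp only: comm that)
  qed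
  have neg: "- v \<in> tangent_space B p" if "v \<in> tangent_space B p" for p v
    using subspace_neg[OF subspace_tangent_space[OF B]] that .
  have d_neg: "differential B A \<iota> p (- v) = - differential B A \<iota> p v"
    if "v \<in> tangent_space B p" for p v
    using differential_linear(2)[OF B A h that that, of "-1"] by simp
  have w_neg: "\<omega> q v (- u) = - \<omega> q v u"
    if "v \<in> tangent_space A q" "u \<in> tangent_space A q" for q v u
  proof -
    have "\<omega> q v ((-1) *\<^sub>R u) = (-1) * \<omega> q v u"
      using w_bilin[of q] that unfolding bilinear_at_def by blast
    then show ?thesis by simp
  qed
  have "smooth_bilin_field B g"
    unfolding g_def using w J
    by (intro smooth_bilin_field_pullback_endo[OF A B h])
       (auto simp: two_form_def almost_complex_structure_def)
  moreover have "g p v u = g p u v"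
    if "v \<in> tangent_space B p" "u \<in> tangent_space B p" for p v u
  proof -
    \<comment> \<open>Here \<open>inv\<close> is read from right to left with second argument
      \<open>J p u\<close>. The double \<open>J\<close> then yields a sign, which skewness absorbs
      while swapping the arguments.\<close>
    have "g p v u = \<omega> (\<iota> p) (differential B A \<iota> p (J p v)) (differential B A \<iota> p (J p (J p u)))"
      using that by (simp add: g_def pullback_def inv JT)
    also have "\<dots> = g p u v"
      using that w_skew[OF dT[OF JT[OF that(1)]] dT[OF that(2)]]
      by (simp add: g_def pullback_def JJ d_neg w_neg dT JT)
    finally show ?thesis .
  qed
  moreover have "nondegenerate B g"
    unfolding nondegenerate_def
  proof (intro allI ballI impI)
    fix p v assume v: "v \<in> tangent_space B p" and 0: "\<forall>u\<in>tangent_space B p. g p v u = 0"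
    have "pullback B A \<iota> \<omega> p v u = 0" if u: "u \<in> tangent_space B p" for u
    proof -
      \<comment> \<open>The test vector is the preimage of \<open>u\<close> under \<open>J\<close>:
        applying \<open>J\<close> to \<open>J p (- u)\<close> gives \<open>u\<close>, so
        \<open>g\<close> becomes the induced form at \<open>v\<close> and \<open>u\<close>.\<close>
      have "g p v (J p (- u)) = 0" using 0 JT neg u by blast
      then show ?thesis using JJ[OF neg[OF u]] by (simp add: g_def)
    qed
    then show "v = 0" using assms(6) v by (auto simp: nondegenerate_def)
  qed
  \<comment> \<open>Unfolding \<open>g\<close> puts one more \<open>J\<close> on the second
    argument, so this is \<open>inv\<close> for \<open>v\<close> and \<open>J p u\<close>.\<close>
  moreover have "g p (J p v) (J p u) = g p v u"
    if "v \<in> tangent_space B p" "u \<in> tangent_space B p" for p v u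
    using that by (simp add: g_def pullback_def inv JT)
  ultimately have "almost_pseudo_hermitian B g J"
    using J by (simp add: almost_pseudo_hermitian_def pseudo_riemannian_metric_def)
  then show ?thesis unfolding g_def .
qed

end
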